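(* Let $p$ and $q$ be nonzero integers with $p - q \neq 1$. Let $(U_n)_{n\ge0}$ be defined by $U_0=0$, $U_1=1$, and $U_n = pU_{n-1}-qU_{n-2}$ for $n\ge2$. Then for all $n \geq 1$, $$\sum_{i=1}^n i\, U_i = \frac{1}{p-q-1} \left( n(U_{n+1} - q U_n) - \frac{\Omega(n)}{p-q-1} \right),$$ where $\Omega(n) = U_{n+1} - 2q U_n + q^2 U_{n-1} + q - 1$.
   Context: $(U_n)$ is the Lucas sequence of the first kind with parameters $p,q$. *)

theory Defs
  imports Complex_Main
begin

fun lucas_U :: "int \<Rightarrow> int \<Rightarrow> nat \<Rightarrow> int" where
  "lucas_U p q 0 = 0"
| "lucas_U p q (Suc 0) = 1"
| "lucas_U p q (Suc (Suc n)) = p * lucas_U p q (Suc n) - q * lucas_U p q n"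

text \<open>The index \<open>n - 1\<close> is truncated subtraction, so this is meant for \<open>n \<ge> 1\<close> only.\<close>

definition lucas_Omega :: "int \<Rightarrow> int \<Rightarrow> nat \<Rightarrow> int" where
  "lucas_Omega p q n =
     lucas_U p q (n + 1) - 2 * q * lucas_U p q n + q\<^sup>2 * lucas_U p q (n - 1) + q - 1"

end

theory Submission
  imports Defs
begin

text \<open>Summation by parts. Put d = p - q - 1 and V_n = U_(n+1) - q U_n. The recurrence gives
  V_(n+1) - V_n = d U_(n+1), so d U is a difference sequence. Also Omega(n) = V_n - q V_(n-1) + q -
  1, hence Omega(n+1) - Omega(n) = d V_n. \<open>lucas_U_weighted_sum\<close> is the formula
  multiplied by d^2, an integer identity that induction can prove; the theorem divides it
  out.\<close>

lemma lucas_U_weighted_sum: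
  fixes p q :: int and m :: nat
  shows "(p - q - 1)\<^sup>2 * (\<Sum>i = 1..Suc m. int i * lucas_U p q i) =
    (p - q - 1) * (int (Suc m) * (lucas_U p q (Suc m + 1) - q * lucas_U p q (Suc m)))
      - lucas_Omega p q (Suc m)"
proof (induction m)
  case 0
  show ?case
    by (simp add: lucas_Omega_def algebra_simps power2_eq_square)
next
  case (Suc m)
  have "(p - q - 1)\<^sup>2 * (\<Sum>i = 1..Suc (Suc m). int i * lucas_U p q i) =
      (p - q - 1)\<^sup>2 * (\<Sum>i = 1..Suc m. int i * lucas_U p q i)
        + (p - q - 1)\<^sup>2 * (int (Suc (Suc m)) * lucas_U p q (Suc (Suc m)))"
    by (simp add: distrib_left)
  \<comment> \<open>With n = m + 1, n V_n grows by (n+1) d U_(n+1) + V_n; times d, the surplus d V_n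
    is exactly the growth of Omega.\<close>
  then show ?case
    unfolding Suc.IH
    by (simp add: lucas_Omega_def algebra_simps power2_eq_square)
qed

theorem theorem4p7:
  fixes p q :: int and n :: nat
  assumes "p \<noteq> 0" and "q \<noteq> 0" and "p - q \<noteq> 1" and "n \<ge> 1"
  shows "(of_int (\<Sum>i = 1..n. int i * lucas_U p q i) :: rat) =
    1 / of_int (p - q - 1) *
      (of_int (int n * (lucas_U p q (n + 1) - q * lucas_U p q n))
        - of_int (lucas_Omega p q n) / of_int (p - q - 1))"
proof -
  define d where "d = p - q - 1"
  define S where "S = (\<Sum>i = 1..n. int i * lucas_U p q i)"
  define E where "E = int n * (lucas_U p q (n + 1) - q * lucas_U p q n)"
  \<comment> \<open>Writing n as a successor makes the \<open>n - 1\<close> in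
    \<open>lucas_Omega\<close> a genuine predecessor.\<close>
  obtain m where "n = Suc m"
    using \<open>n \<ge> 1\<close> by (cases n) auto
  then have "d\<^sup>2 * S = d * E - lucas_Omega p q n"
    using lucas_U_weighted_sum[of p q m] unfolding d_def S_def E_def by simp
  then have "(of_int (d\<^sup>2 * S) :: rat) = of_int (d * E - lucas_Omega p q n)"
    by (rule arg_cong)
  \<comment> \<open>p - q \<noteq> 1 is what permits division by d^2.\<close>
  moreover have "(of_int d :: rat) \<noteq> 0"
    using \<open>p - q \<noteq> 1\<close> unfolding d_def of_int_eq_0_iff by simp
  ultimately have "(of_int S :: rat) =
      1 / of_int d * (of_int E - of_int (lucas_Omega p q n) / of_int d)"
    by (simp add: field_simps power2_eq_square)
  then show ?thesis
    unfolding d_def S_def E_def .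
qed

end
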